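(* Let $d>1$ be an integer. For any integer $k\ge 1$ and any reals $\lambda>0$ and $s>0$, \[ a_{k,\lambda} \ge \frac{\mathbb{E}\{\min\{\mathrm{Po}(\lambda V_d(s)),\, \lfloor k/m(s)\rfloor\}\}}{\lambda V_d(s)}. \] In particular, for every fixed $\lambda>0$, $a_{k,\lambda}\to 1$ as $k\to\infty$.
   Context: For $V \subseteq \mathbb{R}^d$ and $r>0$, $G_r(V)$ is the graph with vertex set $V$ in which two distinct points $u,v\in V$ are adjacent if and only if $\|u-v\|\le r$ (Euclidean norm). For $k \in \mathbb{N}=\{1,2,\dots\}$ and finite $V$, $N_{k,r}(V)$ is the maximum number of vertices of $G_r(V)$ that can be properly colored with $k$ colors, i.e., the largest cardinality of a subset $U\subseteq V$ such that the induced subgraph $G_r(U)$ is $k$-colorable. $\mathcal{X}_\lambda$ is a Poisson point process of (constant) intensity $\lambda$ in $\mathbb{R}^d$. Set $F_{k,\lambda}(t) = N_{k,1}([0,t]^d \cap \mathcal{X}_\lambda)$ and $\overline{F}_{k,\lambda}(t) = \mathbb{E}\{F_{k,\lambda}(t)\}/(\lambda t^d)$ for $t>0$. The constant is $a_{k,\lambda} = \inf_{t>0}\overline{F}_{k,\lambda}(t)$, which also equals $\lim_{t\to\infty}\overline{F}_{k,\lambda}(t)$. $\mathrm{Po}(\mu)$ denotes a Poisson random variable with parameter $\mu$. $V_d(s)=\pi^{d/2}s^d/\Gamma(d/2+1)$ is the volume of a ball of radius $s$ in $\mathbb{R}^d$. For $s>0$, $m(s)$ is the minimum number of sets $B_1,\dots,B_{m(s)}\subseteq\mathbb{R}^d$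 needed such that (i) every point of $\mathbb{R}^d$ is within distance $s$ (i.e., at distance at most $s$) from some point of $B_1\cup\dots\cup B_{m(s)}$, and (ii) for each $m=1,\dots,m(s)$, no two distinct points of $B_m$ are within distance $1+2s$ (i.e., any two distinct points of $B_m$ are at distance greater than $1+2s$). *)

theory Defs
  imports "HOL-Probability.Probability"
begin

text \<open>A simple graph is a pair of a vertex set and a set of two-element edges.\<close>

definition geometric_graph :: "real \<Rightarrow> (real ^ 'n) set \<Rightarrow> (real ^ 'n) set \<times> (real ^ 'n) set set" where
  "geometric_graph r V = (V, {{u, v} | u v. u \<in> V \<and> v \<in> V \<and> u \<noteq> v \<and> norm (u - v) \<le> r})"

definition colorable :: "nat \<Rightarrow> 'v set \<times> 'v set set \<Rightarrow> bool" where
  "colorable k G \<longleftrightarrow>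
     (\<exists>c. (\<forall>v \<in> fst G. c v \<in> {1..k}) \<and> (\<forall>u v. {u, v} \<in> snd G \<longrightarrow> c u \<noteq> c v))"

text \<open>Only meaningful for finite \<open>V\<close>.\<close>

definition max_colorable :: "nat \<Rightarrow> real \<Rightarrow> (real ^ 'n) set \<Rightarrow> nat" where
  "max_colorable k r V = Max {card U | U. U \<subseteq> V \<and> colorable k (geometric_graph r U)}"

text \<open>The library's Poisson distribution is specified for positive rates only; \<open>Po(0)\<close> is the
  point mass at \<open>0\<close>, which is needed for the counts in null sets.\<close>

definition Po :: "real \<Rightarrow> nat pmf" where
  "Po \<mu> = (if \<mu> > 0 then poisson_pmf \<mu> else return_pmf 0)"

text \<open>A homogeneous Poisson point process of intensity \<open>lam\<close>, as a random locally finite set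
  \<open>X\<close> of points on the probability space \<open>M\<close>.\<close>

definition poisson_point_process ::
    "'w measure \<Rightarrow> real \<Rightarrow> ('w \<Rightarrow> (real ^ 'n) set) \<Rightarrow> bool" where
  "poisson_point_process M lam X \<longleftrightarrow>
     prob_space M \<and>
     (\<forall>\<omega> \<in> space M. \<forall>A. bounded A \<longrightarrow> finite (X \<omega> \<inter> A)) \<and>
     (\<forall>A. A \<in> sets borel \<and> bounded A \<longrightarrow>
        (\<lambda>\<omega>. card (X \<omega> \<inter> A)) \<in> M \<rightarrow>\<^sub>M count_space UNIV \<and>
        distr M (count_space UNIV) (\<lambda>\<omega>. card (X \<omega> \<inter> A)) =
          measure_pmf (Po (lam * measure lborel A))) \<and>
     (\<forall>(I :: nat set) A. finite I \<and> (\<forall>i \<in> I. A i \<in> sets borel \<and> bounded (A i)) \<and>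
        disjoint_family_on A I \<longrightarrow>
        prob_space.indep_vars M (\<lambda>_. count_space UNIV) (\<lambda>i \<omega>. card (X \<omega> \<inter> A i)) I)"

definition F_col :: "('w \<Rightarrow> (real ^ 'n) set) \<Rightarrow> nat \<Rightarrow> real \<Rightarrow> 'w \<Rightarrow> nat" where
  "F_col X k t \<omega> = max_colorable k 1 (cbox 0 (\<chi> i. t) \<inter> X \<omega>)"

definition Fbar ::
    "'w measure \<Rightarrow> real \<Rightarrow> ('w \<Rightarrow> (real ^ 'n) set) \<Rightarrow> nat \<Rightarrow> real \<Rightarrow> real" where
  "Fbar M lam X k t = (\<integral>\<omega>. real (F_col X k t \<omega>) \<partial>M) / (lam * t ^ CARD('n))"

text \<open>The constant depends on \<open>M\<close> and \<open>X\<close> only through the law of the process, hence only on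
  \<open>k\<close>, the intensity and the dimension.\<close>

definition a_const ::
    "'w measure \<Rightarrow> real \<Rightarrow> ('w \<Rightarrow> (real ^ 'n) set) \<Rightarrow> nat \<Rightarrow> real" where
  "a_const M lam X k = (INF t \<in> {0<..}. Fbar M lam X k t)"

definition ball_vol :: "nat \<Rightarrow> real \<Rightarrow> real" where
  "ball_vol d s = pi powr (real d / 2) * s ^ d / Gamma (real d / 2 + 1)"

text \<open>The type argument carries the dimension \<open>CARD('n)\<close>.\<close>

definition cover_num :: "'n::finite itself \<Rightarrow> real \<Rightarrow> nat" where
  "cover_num ty s = (LEAST m. \<exists>B :: nat \<Rightarrow> (real ^ 'n) set.
     (\<forall>x. \<exists>y \<in> (\<Union>i \<in> {1..m}. B i). dist x y \<le> s) \<and>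
     (\<forall>i \<in> {1..m}. \<forall>y \<in> B i. \<forall>z \<in> B i. y \<noteq> z \<longrightarrow> dist y z > 1 + 2 * s))"

end

theory Submission
  imports Defs
begin

text \<open>
  Allot every point of the window to the first ball of radius \<open>s\<close> around a center of the cover that
  contains it. The resulting cells are disjoint, fill the window, and have volume at most
  \<open>v = ball_vol d s\<close>. Each of the \<open>m(s)\<close> classes of centers gets its own \<open>K = k div m(s)\<close> colors, and
  every ball of a class reuses them, so at least \<open>min (card (X \<inter> D)) K\<close> points of each cell \<open>D\<close> can
  be colored together. The truncated mean \<open>g(\<mu>) = E min(Po(\<mu>), K)\<close> is concave with \<open>g(0) = 0\<close>, hence
  \<open>g(\<mu>)/\<mu>\<close> decreases, and a cell of volume \<open>w \<le> v\<close> contributes at least \<open>(w/v) g(lam v)\<close>; summing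
  over cells gives the bound for every window. The limit follows since \<open>g(\<mu>) \<rightarrow> \<mu>\<close> as \<open>K \<rightarrow> \<infinity>\<close>.
\<close>

section \<open>Mean and truncated mean of the Poisson distribution\<close>

lemma pmf_Po:
  assumes "\<mu> \<ge> 0"
  shows "pmf (Po \<mu>) n = \<mu> ^ n / fact n * exp (- \<mu>)"
proof (cases "\<mu> = 0")
  case True
  then show ?thesis by (cases n) (simp_all add: Po_def)
next
  case False
  with assms show ?thesis by (simp add: Po_def)
qed

text \<open>The term at 0 vanishes, and shifting the index by one leaves
  \<open>\<mu> * exp (- \<mu>)\<close> times the exponential series. Finiteness of the mean later
  supplies the dominating functions.\<close>

lemma Po_mean:
  assumes "\<mu> \<ge> 0"
  shows "integrable (Po \<mu>) real" "measure_pmf.expectation (Po \<mu>) real = \<mu>"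
proof -
  have "(\<lambda>n. \<mu> * exp (- \<mu>) * (\<mu> ^ n /\<^sub>R fact n)) sums (\<mu> * exp (- \<mu>) * exp \<mu>)"
    by (intro sums_mult exp_converges)
  moreover have "\<mu> * exp (- \<mu>) * (\<mu> ^ n /\<^sub>R fact n) = pmf (Po \<mu>) (Suc n) * real (Suc n)" for n
  proof -
    have "fact (Suc n) = real (Suc n) * fact n" by simp
    then show ?thesis
      unfolding pmf_Po[OF assms] by (simp add: divide_simps del: fact_Suc of_nat_Suc)
  qed
  moreover have "\<mu> * exp (- \<mu>) * exp \<mu> = \<mu>"
    by (simp add: exp_minus)
  ultimately have "(\<lambda>n. pmf (Po \<mu>) (Suc n) * real (Suc n)) sums \<mu>"
    by simp
  then have *: "(\<lambda>n. pmf (Po \<mu>) n * real n) sums \<mu>"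
    using sums_Suc_iff[of "\<lambda>n. pmf (Po \<mu>) n * real n" \<mu>] by simp
  then have i: "integrable (count_space UNIV) (\<lambda>n. pmf (Po \<mu>) n * real n)"
    unfolding integrable_count_space_nat_iff by (simp add: sums_iff)
  show "integrable (Po \<mu>) real"
    unfolding measure_pmf_eq_density using i by (subst integrable_density) auto
  have "measure_pmf.expectation (Po \<mu>) real = (\<integral>n. pmf (Po \<mu>) n * real n \<partial>count_space UNIV)"
    unfolding measure_pmf_eq_density by (subst integral_density) auto
  also have "\<dots> = \<mu>"
    using * i by (subst integral_count_space_nat) (simp_all add: sums_iff)
  finally show "measure_pmf.expectation (Po \<mu>) real = \<mu>" .
qed

definition Po_min :: "nat \<Rightarrow> real \<Rightarrow> real" where
  "Po_min K \<mu> = measure_pmf.expectation (Po \<mu>) (\<lambda>n. real (min n K))"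

lemma Po_min_0 [simp]: "Po_min K 0 = 0"
  by (simp add: Po_min_def Po_def)

text \<open>Truncation makes the defect \<open>K - min n K\<close> finitely supported, so that derivatives can be
  taken termwise.\<close>

lemma Po_min_eq:
  assumes "\<mu> \<ge> 0"
  shows "Po_min K \<mu> = K - (\<Sum>n<K. (real K - real n) * (\<mu> ^ n / fact n * exp (- \<mu>)))"
proof -
  have i: "integrable (Po \<mu>) (\<lambda>n. real (min n K))"
    by (rule measure_pmf.integrable_const_bound[where B=K]) auto
  have "K - Po_min K \<mu> = measure_pmf.expectation (Po \<mu>) (\<lambda>n. K - real (min n K))"
    unfolding Po_min_def by (subst Bochner_Integration.integral_diff) (auto simp: i)
  also have "\<dots> = (\<Sum>n<K. (K - real (min n K)) * pmf (Po \<mu>) n)"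
    by (rule integral_measure_pmf_real) (auto simp: min_def split: if_splits)
  also have "\<dots> = (\<Sum>n<K. (real K - real n) * (\<mu> ^ n / fact n * exp (- \<mu>)))"
    by (rule sum.cong) (auto simp: pmf_Po[OF assms])
  finally show ?thesis by simp
qed

text \<open>Differentiating a Poisson weight gives the difference of two neighbouring weights, so
  sums of derivatives telescope.\<close>

lemma DERIV_poisson_term_Suc:
  "((\<lambda>x::real. x ^ Suc n / fact (Suc n) * exp (- x)) has_real_derivative
     (x ^ n / fact n * exp (- x) - x ^ Suc n / fact (Suc n) * exp (- x))) (at x)"
proof -
  have "((\<lambda>x::real. x ^ Suc n / fact (Suc n) * exp (- x)) has_real_derivative
     (real (Suc n) * x ^ n / fact (Suc n) * exp (- x) - x ^ Suc n / fact (Suc n) * exp (- x))) (at x)"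
    by (auto intro!: derivative_eq_intros simp: diff_divide_distrib simp del: fact_Suc power_Suc)
  moreover have "real (Suc n) * x ^ n / fact (Suc n) = x ^ n / fact n"
    by (simp add: divide_simps del: of_nat_Suc)
  ultimately show ?thesis by simp
qed

lemma DERIV_poisson_cdf:
  "((\<lambda>x::real. \<Sum>n<Suc K. x ^ n / fact n * exp (- x)) has_real_derivative
     - (x ^ K / fact K * exp (- x))) (at x)"
proof (induction K)
  case 0
  show ?case by (auto intro!: derivative_eq_intros)
next
  case (Suc K)
  show ?case
    unfolding sum.lessThan_Suc[of _ "Suc K"]
    by (rule DERIV_cong[OF DERIV_add[OF Suc DERIV_poisson_term_Suc]]) simp
qed

text \<open>Raising K by one adds one more distribution function to the defect, whose derivative is
  a single weight; the induction collects these weights.\<close>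

lemma DERIV_poisson_defect:
  "((\<lambda>x::real. \<Sum>n<K. (real K - real n) * (x ^ n / fact n * exp (- x))) has_real_derivative
     - (\<Sum>n<K. x ^ n / fact n * exp (- x))) (at x)"
proof (induction K)
  case 0
  show ?case by simp
next
  case (Suc K)
  have *: "(\<lambda>x::real. \<Sum>n<Suc K. (real (Suc K) - real n) * (x ^ n / fact n * exp (- x))) =
     (\<lambda>x. (\<Sum>n<K. (real K - real n) * (x ^ n / fact n * exp (- x)))
        + (\<Sum>n<Suc K. x ^ n / fact n * exp (- x)))"
    by (auto simp: sum.distrib[symmetric] algebra_simps add_divide_distrib diff_divide_distrib
        intro!: sum.cong)
  show ?case
    unfolding * by (rule DERIV_cong[OF DERIV_add[OF Suc DERIV_poisson_cdf]]) simp
qed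

text \<open>\<open>Po_min\<close> is K minus the defect, and the second derivative of the defect is
  the Poisson weight at K - 1, which is nonnegative. K = 0 has no such weight, hence the case
  split.\<close>

lemma concave_Po_min: "concave_on {0..} (Po_min K)"
proof (cases K)
  case 0
  then show ?thesis by (simp add: Po_min_def concave_on_iff)
next
  case (Suc J)
  have "convex_on {0..} (\<lambda>x::real. \<Sum>n<K. (real K - real n) * (x ^ n / fact n * exp (- x)))"
    (is "convex_on _ ?G")
  proof (rule f''_ge0_imp_convex)
    show "(?G has_real_derivative - (\<Sum>n<K. x ^ n / fact n * exp (- x))) (at x)" for x
      by (rule DERIV_poisson_defect)
    show "((\<lambda>x. - (\<Sum>n<K. x ^ n / fact n * exp (- x))) has_real_derivative
       x ^ J / fact J * exp (- x)) (at x)" for x :: real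
      using DERIV_minus[OF DERIV_poisson_cdf[of J x]] unfolding Suc by simp
  qed auto
  then have "concave_on {0..} (\<lambda>x. real K - ?G x)"
    by (intro concave_on_diff) (auto simp: concave_on_const)
  then show ?thesis
    unfolding concave_on_iff by (auto simp: Po_min_eq)
qed

text \<open>Concavity on the segment from 0, where \<open>Po_min\<close> vanishes. Clearing
  denominators admits rate 0, which occurs for cells of volume 0.\<close>

lemma Po_min_scale:
  assumes "0 \<le> \<mu>" "\<mu> \<le> \<nu>"
  shows "\<mu> * Po_min K \<nu> \<le> \<nu> * Po_min K \<mu>"
proof (cases "\<nu> = 0")
  case False
  with assms have "\<nu> > 0" by simp
  have "(1 - \<mu> / \<nu>) * Po_min K 0 + \<mu> / \<nu> * Po_min K \<nu>
      \<le> Po_min K ((1 - \<mu> / \<nu>) *\<^sub>R 0 + (\<mu> / \<nu>) *\<^sub>R \<nu>)"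
    using assms \<open>\<nu> > 0\<close> by (intro concave_onD[OF concave_Po_min]) auto
  then show ?thesis
    using \<open>\<nu> > 0\<close> by (simp add: field_simps)
qed (use assms in simp)

text \<open>Dominated convergence: the truncations are eventually constant at each point and bounded
  by the identity, which has finite mean.\<close>

lemma Po_min_tendsto:
  assumes "\<mu> \<ge> 0"
  shows "(\<lambda>K. Po_min K \<mu>) \<longlonglongrightarrow> \<mu>"
proof -
  have "(\<lambda>K. measure_pmf.expectation (Po \<mu>) (\<lambda>n. real (min n K)))
      \<longlonglongrightarrow> measure_pmf.expectation (Po \<mu>) real"
  proof (rule integral_dominated_convergence[where w=real])
    show "AE n in Po \<mu>. (\<lambda>K. real (min n K)) \<longlonglongrightarrow> real n"
    proof (rule AE_I2)
      fix n
      have "\<forall>\<^sub>F K in sequentially. real (min n K) = real n"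
        using eventually_ge_at_top[of n] by eventually_elim simp
      then show "(\<lambda>K. real (min n K)) \<longlonglongrightarrow> real n"
        by (rule tendsto_eventually)
    qed
  qed (use Po_mean[OF assms] in auto)
  then show ?thesis
    using Po_mean[OF assms] by (simp add: Po_min_def)
qed

section \<open>Colorable subsets of geometric graphs\<close>

lemma colorable_geometric_graph_iff:
  "colorable k (geometric_graph r U) \<longleftrightarrow>
     (\<exists>c. (\<forall>v \<in> U. c v \<in> {1..k}) \<and> (\<forall>u \<in> U. \<forall>v \<in> U. u \<noteq> v \<and> dist u v \<le> r \<longrightarrow> c u \<noteq> c v))"
proof -
  have "{u, v} \<in> snd (geometric_graph r U) \<longleftrightarrow> u \<in> U \<and> v \<in> U \<and> u \<noteq> v \<and> dist u v \<le> r" for u v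
    by (auto simp: geometric_graph_def dist_norm doubleton_eq_iff norm_minus_commute)
  then show ?thesis
    by (auto simp: colorable_def geometric_graph_def)
qed

lemma le_max_colorable_iff:
  fixes V :: "(real ^ 'n) set"
  assumes "finite V"
  shows "m \<le> max_colorable k r V \<longleftrightarrow> (\<exists>U \<subseteq> V. colorable k (geometric_graph r U) \<and> m \<le> card U)"
proof -
  let ?A = "{card U | U. U \<subseteq> V \<and> colorable k (geometric_graph r U)}"
  have "?A \<subseteq> card ` Pow V" by auto
  then have "finite ?A"
    using assms by (meson finite_Pow_iff finite_imageI finite_subset)
  \<comment> \<open>The empty set is colorable even for k = 0, so \<open>Max\<close> ranges over a
    nonempty set.\<close>
  moreover have "colorable k (geometric_graph r ({} :: (real ^ 'n) set))"
    by (simp add: colorable_geometric_graph_iff)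
  then have "card ({} :: (real ^ 'n) set) \<in> ?A" by blast
  then have "?A \<noteq> {}" by blast
  ultimately show ?thesis
    unfolding max_colorable_def by (subst Max_ge_iff) auto
qed

lemma max_colorable_le_card:
  assumes "finite V"
  shows "max_colorable k r V \<le> card V"
proof -
  obtain U where "U \<subseteq> V" "max_colorable k r V \<le> card U"
    using le_max_colorable_iff[OF assms, of "max_colorable k r V" k r] by auto
  then show ?thesis using card_mono[OF assms \<open>U \<subseteq> V\<close>] by simp
qed

text \<open>Non-adjacency is the open condition \<open>dist x y > r\<close>, so a colored point set can be witnessed
  by finitely many colored basic open sets; this reduces the event \<open>m \<le> max_colorable k r V\<close> to
  countably many hitting events.\<close>

definition separated_colored :: "real \<Rightarrow> ('a::metric_space set \<times> nat) set \<Rightarrow> bool" where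
  "separated_colored r S \<longleftrightarrow>
     (\<forall>e \<in> S. \<forall>e' \<in> S. e \<noteq> e' \<longrightarrow>
        fst e \<inter> fst e' = {} \<and> (snd e = snd e' \<longrightarrow> (\<forall>x \<in> fst e. \<forall>y \<in> fst e'. r < dist x y)))"

text \<open>From left to right, each point of a colored set is surrounded by a basic set small
  enough to preserve all strict separations. Conversely, one point picked from each hit set inherits
  the color of its pair.\<close>

lemma le_max_colorable_iff_basis:
  fixes V :: "(real ^ 'n) set"
  assumes V: "finite V" and B: "topological_basis B"
  shows "m \<le> max_colorable k r V \<longleftrightarrow>
    (\<exists>S. finite S \<and> S \<subseteq> B \<times> {1..k} \<and> m \<le> card S \<and> separated_colored r S \<and>
       (\<forall>e \<in> S. V \<inter> fst e \<noteq> {}))"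
    (is "?L \<longleftrightarrow> ?R")
proof
  assume ?L
  then obtain U c where U: "U \<subseteq> V" "m \<le> card U" and c: "\<And>v. v \<in> U \<Longrightarrow> c v \<in> {1..k}"
    and sep: "\<And>u v. u \<in> U \<Longrightarrow> v \<in> U \<Longrightarrow> u \<noteq> v \<Longrightarrow> c u = c v \<Longrightarrow> r < dist u v"
    unfolding le_max_colorable_iff[OF V] colorable_geometric_graph_iff by (metis not_le)
  have finU: "finite U" using U V finite_subset by blast
  \<comment> \<open>The slack of a pair: its distance, for disjointness of the neighbourhoods, and
    for equal colors also the excess over r. The \<open>min\<close> covers negative r.\<close>
  define gap where "gap p = (if c (fst p) = c (snd p)
    then min (dist (fst p) (snd p)) (dist (fst p) (snd p) - r) else dist (fst p) (snd p))" for p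
  \<comment> \<open>The extra element 1 keeps \<open>Min A\<close> meaningful when U has at most one
    point.\<close>
  define A where "A = insert 1 (gap ` {p \<in> U \<times> U. fst p \<noteq> snd p})"
  have finA: "finite A" using finU by (auto simp: A_def)
  have "\<forall>a \<in> A. a > 0" using sep by (auto simp: A_def gap_def)
  \<comment> \<open>Half the least slack: moving both points of a pair by less than
    \<open>\<epsilon>\<close> lowers their distance by less than the slack.\<close>
  define \<epsilon> where "\<epsilon> = Min A / 2"
  have \<epsilon>: "\<epsilon> > 0" using finA \<open>\<forall>a \<in> A. a > 0\<close> by (auto simp: \<epsilon>_def A_def)
  have gap: "2 * \<epsilon> \<le> gap (u, v)" if "u \<in> U" "v \<in> U" "u \<noteq> v" for u v
    using finA that by (auto simp: \<epsilon>_def A_def intro!: Min_le)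
  have "\<exists>Q \<in> B. x \<in> Q \<and> Q \<subseteq> ball x \<epsilon>" for x
    using topological_basisE[OF B open_ball] \<epsilon> by (metis centre_in_ball)
  then obtain Q where Q: "\<And>x. Q x \<in> B" "\<And>x. x \<in> Q x" "\<And>x. Q x \<subseteq> ball x \<epsilon>" by metis
  have near: "dist u v < dist x y + 2 * \<epsilon>" if "x \<in> Q u" "y \<in> Q v" for u v x y
  proof -
    have "dist u x < \<epsilon>" "dist v y < \<epsilon>" using Q(3) that by (auto simp: subset_iff)
    then show ?thesis
      using dist_triangle[of u v x] dist_triangle[of x v y] by (simp add: dist_commute)
  qed
  have disj: "Q u \<inter> Q v = {}" if "u \<in> U" "v \<in> U" "u \<noteq> v" for u v
    using near[of _ u _ v] gap[OF that] by (fastforce simp: gap_def split: if_splits)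
  define S where "S = (\<lambda>u. (Q u, c u)) ` U"
  have "inj_on (\<lambda>u. (Q u, c u)) U"
    using disj Q(2) by (fastforce intro!: inj_onI)
  then have "card S = card U" by (simp add: S_def card_image)
  moreover have "separated_colored r S"
  proof -
    have "r < dist x y" if "u \<in> U" "v \<in> U" "u \<noteq> v" "c u = c v" "x \<in> Q u" "y \<in> Q v" for u v x y
      using near[OF that(5,6)] gap[OF that(1-3)] that(4) by (auto simp: gap_def)
    then show ?thesis
      using disj unfolding separated_colored_def S_def by fastforce
  qed
  moreover have "S \<subseteq> B \<times> {1..k}" "\<forall>e \<in> S. V \<inter> fst e \<noteq> {}"
    using Q c U by (auto simp: S_def)
  moreover have "finite S" "m \<le> card S"
    using U finU \<open>card S = card U\<close> by (simp_all add: S_def)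
  ultimately show ?R by blast
next
  assume ?R
  then obtain S where S: "finite S" "S \<subseteq> B \<times> {1..k}" "m \<le> card S"
    and sep: "separated_colored r S" and hit: "\<forall>e \<in> S. V \<inter> fst e \<noteq> {}"
    by blast
  define p where "p e = (SOME x. x \<in> V \<inter> fst e)" for e :: "(real ^ 'n) set \<times> nat"
  have p: "p e \<in> V \<inter> fst e" if "e \<in> S" for e
    unfolding p_def some_in_eq using hit that by blast
  \<comment> \<open>Pairs in S have disjoint first components, so no point is picked twice and the
    color can be read back from the point.\<close>
  have inj: "inj_on p S"
  proof (rule inj_onI, rule ccontr)
    fix e e' assume e: "e \<in> S" "e' \<in> S" "p e = p e'" "e \<noteq> e'"
    then have "fst e \<inter> fst e' = {}" using sep unfolding separated_colored_def by blast
    then show False using p[OF e(1)] p[OF e(2)] e(3) by auto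
  qed
  define c where "c u = snd (the_inv_into S p u)" for u
  have c: "c (p e) = snd e" if "e \<in> S" for e
    using that inj by (simp add: c_def the_inv_into_f_f)
  have "colorable k (geometric_graph r (p ` S))"
    unfolding colorable_geometric_graph_iff
  proof (intro exI[of _ c] conjI ballI impI)
    fix v assume "v \<in> p ` S"
    then show "c v \<in> {1..k}" using S c by force
  next
    fix u v assume uv: "u \<in> p ` S" "v \<in> p ` S" "u \<noteq> v \<and> dist u v \<le> r"
    then obtain e e' where "e \<in> S" "e' \<in> S" "u = p e" "v = p e'" "e \<noteq> e'" by blast
    moreover have "r < dist (p e) (p e')" if "snd e = snd e'"
      using sep p that \<open>e \<in> S\<close> \<open>e' \<in> S\<close> \<open>e \<noteq> e'\<close> unfolding separated_colored_def by blast
    ultimately show "c u \<noteq> c v"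
      using uv c[OF \<open>e \<in> S\<close>] c[OF \<open>e' \<in> S\<close>] by auto
  qed
  then show ?L
    unfolding le_max_colorable_iff[OF V] using p S inj by (intro exI[of _ "p ` S"]) (auto simp: card_image)
qed

section \<open>Covers by separated classes of centers\<close>

text \<open>By Bolzano-Weierstrass an infinite bounded set has a limit point, and a ball of radius
  \<open>\<delta> / 2\<close> around it would hold two points closer than
  \<open>\<delta>\<close>.\<close>

lemma finite_of_bounded_separated:
  fixes S :: "'a::heine_borel set"
  assumes "bounded S" "\<delta> > 0" and sep: "\<And>x y. x \<in> S \<Longrightarrow> y \<in> S \<Longrightarrow> x \<noteq> y \<Longrightarrow> \<delta> < dist x y"
  shows "finite S"
proof (rule ccontr)
  assume "infinite S"
  then obtain x where "x islimpt S"
    using bounded_infinite_imp_islimpt[OF subset_refl \<open>bounded S\<close>] by blast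
  then have "infinite (S \<inter> ball x (\<delta> / 2))"
    using islimpt_eq_infinite_ball \<open>\<delta> > 0\<close> by (metis half_gt_zero)
  then obtain y z where "y \<in> S \<inter> ball x (\<delta> / 2)" "z \<in> S \<inter> ball x (\<delta> / 2)" "y \<noteq> z"
    by (metis finite.emptyI finite_insert insertI1 insert_iff subsetI finite_subset)
  then show False
    using sep[of y z] dist_triangle_half_r[of x y \<delta> z] by force
qed

text \<open>The condition minimized in \<open>cover_num\<close>, with the number of classes and the
  classes as arguments.\<close>

definition separated_cover :: "real \<Rightarrow> nat \<Rightarrow> (nat \<Rightarrow> (real ^ 'n) set) \<Rightarrow> bool" where
  "separated_cover s m B \<longleftrightarrow>
     (\<forall>x. \<exists>y \<in> (\<Union>i \<in> {1..m}. B i). dist x y \<le> s) \<and>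
     (\<forall>i \<in> {1..m}. \<forall>y \<in> B i. \<forall>z \<in> B i. y \<noteq> z \<longrightarrow> dist y z > 1 + 2 * s)"

text \<open>The witness is a fine cubic grid, split into residue classes modulo a large integer.\<close>

lemma separated_cover_exists:
  assumes s: "s > 0"
  shows "\<exists>m (B :: nat \<Rightarrow> (real ^ 'n) set). separated_cover s m B"
proof -
  \<comment> \<open>Rounding down to the grid costs at most \<open>\<epsilon>\<close> per
    coordinate, hence at most s in the l1 norm, which bounds the Euclidean one.\<close>
  define \<epsilon> where "\<epsilon> = s / CARD('n)"
  have \<epsilon>: "\<epsilon> > 0" using s by (simp add: \<epsilon>_def)
  \<comment> \<open>Distinct grid points with the same residues modulo L differ by at least
    \<open>\<epsilon> * L\<close> in some coordinate, so this must exceed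
    \<open>1 + 2 * s\<close>.\<close>
  obtain L :: nat where "(1 + 2 * s) / \<epsilon> < L" using reals_Archimedean2 by blast
  then have L: "1 + 2 * s < \<epsilon> * L" using \<epsilon> by (simp add: field_simps)
  then have Lpos: "L > 0" using s by (cases L) auto
  define R :: "('n \<Rightarrow> int) set" where "R = UNIV \<rightarrow>\<^sub>E {0..<int L}"
  have "finite R" unfolding R_def by (intro finite_PiE) auto
  then obtain h where h: "bij_betw h {1..card R} R" using ex_bij_betw_nat_finite_1 by blast
  define C :: "('n \<Rightarrow> int) \<Rightarrow> (real ^ 'n) set"
    where "C \<rho> = {\<chi> i. \<epsilon> * z i | z :: 'n \<Rightarrow> int. \<forall>i. z i mod int L = \<rho> i}" for \<rho>
  have "\<exists>y \<in> (\<Union>i \<in> {1..card R}. C (h i)). dist x y \<le> s" for x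
  proof -
    define z where "z i = \<lfloor>x $ i / \<epsilon>\<rfloor>" for i
    define y :: "real ^ 'n" where "y = (\<chi> i. \<epsilon> * z i)"
    have "(\<lambda>i. z i mod int L) \<in> R" using Lpos by (auto simp: R_def)
    then obtain i where "i \<in> {1..card R}" "h i = (\<lambda>i. z i mod int L)"
      using h by (metis bij_betw_iff_bijections)
    moreover have "y \<in> C (\<lambda>i. z i mod int L)" unfolding C_def y_def by blast
    ultimately have "y \<in> (\<Union>i \<in> {1..card R}. C (h i))" by (metis UN_I)
    moreover have "\<bar>(x - y) $ i\<bar> \<le> \<epsilon>" for i
    proof -
      have "real_of_int (z i) \<le> x $ i / \<epsilon>" "x $ i / \<epsilon> < z i + 1" unfolding z_def by linarith+
      then show ?thesis using \<epsilon> by (simp add: y_def field_simps abs_le_iff)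
    qed
    then have "dist x y \<le> s"
      using norm_le_l1_cart[of "x - y"] sum_bounded_above[of UNIV "\<lambda>i. \<bar>(x - y) $ i\<bar>" \<epsilon>]
      by (simp add: dist_norm \<epsilon>_def)
    ultimately show ?thesis by blast
  qed
  moreover have "1 + 2 * s < dist y w" if yw: "y \<in> C \<rho>" "w \<in> C \<rho>" "y \<noteq> w" for y w \<rho>
  proof -
    obtain z z' where z: "y = (\<chi> i. \<epsilon> * z i)" "\<And>i. z i mod int L = \<rho> i"
      and z': "w = (\<chi> i. \<epsilon> * z' i)" "\<And>i. z' i mod int L = \<rho> i"
      using yw by (auto simp: C_def)
    have "z \<noteq> z'" using \<open>y \<noteq> w\<close> unfolding z(1) z'(1) by blast
    then obtain i where "z i \<noteq> z' i" by blast
    moreover have "z i mod int L = z' i mod int L" unfolding z(2) z'(2) ..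
    then have "int L dvd z i - z' i" by (rule mod_eq_dvd_iff[THEN iffD1])
    ultimately have "int L \<le> \<bar>z i - z' i\<bar>"
      using dvd_imp_le_int[of "z i - z' i" "int L"] by simp
    then have "real L \<le> \<bar>real_of_int (z i) - z' i\<bar>" by linarith
    then have "\<epsilon> * L \<le> \<epsilon> * \<bar>real_of_int (z i) - z' i\<bar>" using \<epsilon> by simp
    also have "\<dots> = \<bar>(y - w) $ i\<bar>"
      using \<epsilon> by (simp add: z(1) z'(1) right_diff_distrib[symmetric] abs_mult)
    also have "\<dots> \<le> dist y w" unfolding dist_norm by (rule component_le_norm_cart)
    finally show ?thesis using L by simp
  qed
  ultimately have "separated_cover s (card R) (\<lambda>i. C (h i))"
    unfolding separated_cover_def by blast
  then show ?thesis by blast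
qed

text \<open>Since some separated cover exists, the \<open>LEAST\<close> in \<open>cover_num\<close>
  is attained.\<close>

lemma cover_num_cover:
  assumes "s > 0"
  obtains B :: "nat \<Rightarrow> (real ^ 'n) set" where "separated_cover s (cover_num TYPE('n) s) B"
proof -
  have "cover_num TYPE('n) s = (LEAST m. \<exists>B :: nat \<Rightarrow> (real ^ 'n) set. separated_cover s m B)"
    unfolding cover_num_def separated_cover_def ..
  then show thesis
    using LeastI_ex[OF separated_cover_exists[OF assms, where 'n='n]] that by auto
qed

text \<open>With no classes nothing would cover the origin. Positivity makes
  \<open>k div cover_num\<close> grow with k, as division by 0 would give 0.\<close>

lemma cover_num_pos:
  assumes "s > 0"
  shows "cover_num TYPE('n::finite) s > 0"
proof -
  obtain B :: "nat \<Rightarrow> (real ^ 'n) set" where "separated_cover s (cover_num TYPE('n) s) B"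
    using cover_num_cover[OF assms] by blast
  then have "\<exists>y \<in> (\<Union>i \<in> {1..cover_num TYPE('n) s}. B i). dist 0 y \<le> s"
    unfolding separated_cover_def by blast
  then show ?thesis by (auto intro: Suc_le_lessD)
qed

section \<open>Cells of a window and their joint coloring\<close>

text \<open>Only centers within s of the bounded window matter. In each class these are bounded and
  separated, hence finite in number, so they can be listed and their balls made disjoint in list
  order.\<close>

lemma window_cells:
  fixes W :: "(real ^ 'n) set" and B :: "nat \<Rightarrow> (real ^ 'n) set"
  assumes cov: "separated_cover s m B" and s: "s > 0" and W: "bounded W" "W \<in> sets borel"
  obtains N :: nat and c y D where
    "\<And>j. j < N \<Longrightarrow> c j \<in> {1..m}"
    "\<And>j l. j < N \<Longrightarrow> l < N \<Longrightarrow> j \<noteq> l \<Longrightarrow> c j = c l \<Longrightarrow> dist (y j) (y l) > 1 + 2 * s"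
    "\<And>j. D j \<subseteq> W \<inter> cball (y j) s" "\<And>j. D j \<in> sets borel"
    "disjoint_family D" "(\<Union>j<N. D j) = W"
proof -
  define Y where "Y i = B i \<inter> {y. \<exists>x \<in> W. dist x y \<le> s}" for i
  obtain a \<rho> where \<rho>: "\<And>x. x \<in> W \<Longrightarrow> dist a x \<le> \<rho>" using W bounded_def by metis
  have "bounded (Y i)" for i
  proof (rule boundedI[where B="norm a + \<rho> + s", OF _])
    fix y assume "y \<in> Y i"
    then obtain x where "x \<in> W" "dist x y \<le> s" by (auto simp: Y_def)
    then have "dist a y \<le> \<rho> + s" using \<rho>[of x] dist_triangle[of a y x] by simp
    then show "norm y \<le> norm a + \<rho> + s"
      using norm_triangle_sub[of y a] by (simp add: dist_norm norm_minus_commute)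
  qed
  moreover have sep: "1 + 2 * s < dist x y" if "i \<in> {1..m}" "x \<in> Y i" "y \<in> Y i" "x \<noteq> y" for i x y
    using cov that by (auto simp: separated_cover_def Y_def)
  ultimately have "finite (Y i)" if "i \<in> {1..m}" for i
    using that s by (intro finite_of_bounded_separated[of "Y i" "1 + 2 * s"]) auto
  then have "finite (\<Union>i \<in> {1..m}. Y i)" by blast
  then obtain y where y: "bij_betw y {0..<card (\<Union>i \<in> {1..m}. Y i)} (\<Union>i \<in> {1..m}. Y i)"
    using ex_bij_betw_nat_finite by blast
  define N where "N = card (\<Union>i \<in> {1..m}. Y i)"
  have "\<exists>i \<in> {1..m}. y j \<in> Y i" if "j < N" for j
    using y that unfolding N_def bij_betw_def by fastforce
  \<comment> \<open>A center may lie in several classes; one is fixed for it.\<close>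
  then obtain c where c: "\<And>j. j < N \<Longrightarrow> c j \<in> {1..m}" "\<And>j. j < N \<Longrightarrow> y j \<in> Y (c j)" by metis
  define D where "D = disjointed (\<lambda>j. W \<inter> cball (y j) s)"
  have "(\<Union>j<N. D j) = (\<Union>j<N. W \<inter> cball (y j) s)"
    unfolding D_def lessThan_atLeast0 by (rule finite_UN_disjointed_eq)
  also have "\<dots> = W"
  proof -
    have "\<exists>j \<in> {..<N}. dist (y j) x \<le> s" if "x \<in> W" for x
    proof -
      obtain z where "z \<in> (\<Union>i \<in> {1..m}. B i)" "dist x z \<le> s"
        using cov unfolding separated_cover_def by blast
      then have "z \<in> (\<Union>i \<in> {1..m}. Y i)" using that by (auto simp: Y_def)
      then have "z \<in> y ` {0..<N}" using y unfolding N_def bij_betw_def by blast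
      then obtain j where "j < N" "y j = z" by auto
      then show ?thesis using \<open>dist x z \<le> s\<close> by (auto simp: dist_commute)
    qed
    then show ?thesis by auto
  qed
  finally have 1: "(\<Union>j<N. D j) = W" .
  have 2: "D j \<subseteq> W \<inter> cball (y j) s" for j
    unfolding D_def by (rule disjointed_subset)
  have 3: "D j \<in> sets borel" for j
    unfolding D_def disjointed_def using W by (intro sets.Diff sets.finite_UN sets.Int) auto
  have 4: "dist (y j) (y l) > 1 + 2 * s" if "j < N" "l < N" "j \<noteq> l" "c j = c l" for j l
  proof -
    have "y j \<noteq> y l"
      using inj_on_eq_iff[OF bij_betw_imp_inj_on[OF y], of j l] that by (simp add: N_def)
    then show ?thesis using sep[of "c j" "y j" "y l"] c[of j] c(2)[of l] that by simp
  qed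
  have 5: "disjoint_family D" unfolding D_def by (rule disjoint_family_disjointed)
  from that[OF c(1) 4 2 3 5 1] show thesis .
qed

text \<open>Class \<open>i\<close> of the cover gets the colors \<open>(i - 1) * K + 1, \<dots>, i * K\<close>; points of distinct balls in
  the same class are more than \<open>1\<close> apart, so each ball may reuse all \<open>K\<close> colors of its class.\<close>

lemma max_colorable_ge_sum:
  fixes P :: "(real ^ 'n) set" and N :: nat
  assumes P: "finite P" and k: "m * K \<le> k"
    and c: "\<And>j. j < N \<Longrightarrow> c j \<in> {1..m}"
    and sep: "\<And>j l. j < N \<Longrightarrow> l < N \<Longrightarrow> j \<noteq> l \<Longrightarrow> c j = c l \<Longrightarrow> dist (y j) (y l) > 1 + 2 * s"
    and D: "\<And>j. D j \<subseteq> cball (y j) s" "disjoint_family D"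
  shows "(\<Sum>j<N. min (card (P \<inter> D j)) K) \<le> max_colorable k 1 P"
proof -
  have "\<exists>U \<subseteq> P \<inter> D j. card U = min (card (P \<inter> D j)) K" for j
    by (meson min.cobounded1 obtain_subset_with_card_n)
  then obtain U where U: "\<And>j. U j \<subseteq> P \<inter> D j" "\<And>j. card (U j) = min (card (P \<inter> D j)) K" by metis
  have finU: "finite (U j)" for j using U(1) P by (meson finite_Int finite_subset)
  then have "\<exists>f. bij_betw f (U j) {0..<card (U j)}" for j by (rule ex_bij_betw_finite_nat)
  then obtain f where f: "\<And>j. bij_betw (f j) (U j) {0..<card (U j)}" by metis
  have fK: "f j x < K" if "x \<in> U j" for j x
    using f[of j] that U(2)[of j] unfolding bij_betw_def by fastforce
  define ix where "ix x = (THE j. x \<in> D j)" for x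
  have ix: "ix x = j" if "x \<in> U j" for x j
    unfolding ix_def using that U(1) D(2)
    by (intro the_equality) (use U(1) in blast, metis IntI IntD2 UNIV_I disjoint_family_onD empty_iff subsetD)
  \<comment> \<open>\<open>c\<close> counts from 1 and \<open>f\<close> from 0, hence the
    \<open>- 1\<close> and the \<open>+ 1\<close>. Disjointness of the cells makes \<open>ix\<close>
    well defined on the chosen points.\<close>
  define col where "col x = (c (ix x) - 1) * K + f (ix x) x + 1" for x
  have "colorable k (geometric_graph 1 (\<Union>j<N. U j))"
    unfolding colorable_geometric_graph_iff
  proof (intro exI[of _ col] conjI ballI impI)
    fix x assume "x \<in> (\<Union>j<N. U j)"
    then obtain j where j: "j < N" "x \<in> U j" by auto
    have "(c j - 1) * K + f j x + 1 \<le> (c j - 1) * K + K" using fK[OF j(2)] by simp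
    also have "\<dots> = c j * K" using c[OF j(1)] by (cases "c j") auto
    also have "\<dots> \<le> k" using c[OF j(1)] k by (meson atLeastAtMost_iff mult_le_mono1 order_trans)
    finally show "col x \<in> {1..k}" using ix j by (simp add: col_def)
  next
    fix u v assume uv: "u \<in> (\<Union>j<N. U j)" "v \<in> (\<Union>j<N. U j)" "u \<noteq> v \<and> dist u v \<le> 1"
    then obtain j l where j: "j < N" "u \<in> U j" and l: "l < N" "v \<in> U l" by auto
    show "col u \<noteq> col v"
    proof
      assume "col u = col v"
      then have eq: "(c j - 1) * K + f j u = (c l - 1) * K + f l v"
        using ix j l by (simp add: col_def)
      \<comment> \<open>Both offsets are below K, so the quotient recovers the class and then the
        offsets agree as well.\<close>
      from eq have "((c j - 1) * K + f j u) div K = ((c l - 1) * K + f l v) div K" by simp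
      moreover have "f j u < K" "f l v < K" using fK j l by auto
      ultimately have "c j - 1 = c l - 1" by (simp add: div_mult_self3)
      then have "c j = c l" and "f j u = f l v" using c[OF j(1)] c[OF l(1)] eq by auto
      show False
      proof (cases "j = l")
        case True
        then show False
          using \<open>f j u = f l v\<close> f[of j] j l uv unfolding bij_betw_def inj_on_def by blast
      next
        case False
        \<comment> \<open>The centers are more than \<open>1 + 2 * s\<close> apart and each point is
          within s of its center, so the points cannot be within 1.\<close>
        have "dist (y j) u \<le> s" "dist (y l) v \<le> s" using D(1) U(1) j l by fastforce+
        moreover have "dist (y j) (y l) > 1 + 2 * s" using sep False j l \<open>c j = c l\<close> by blast
        ultimately show False
          using uv dist_triangle[of "y j" "y l" u] dist_triangle[of u "y l" v]
          by (simp add: dist_commute)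
      qed
    qed
  qed
  moreover have "card (\<Union>j<N. U j) = (\<Sum>j<N. min (card (P \<inter> D j)) K)"
    using finU U D(2) by (subst card_UN_disjoint) (auto simp: disjoint_family_on_def, blast)
  moreover have "(\<Union>j<N. U j) \<subseteq> P" using U by blast
  ultimately show ?thesis
    unfolding le_max_colorable_iff[OF P] by (metis order_refl)
qed

section \<open>Poisson counts and measurability of the colorable number\<close>

lemma poisson_point_process_finite:
  assumes "poisson_point_process M lam X" "\<omega> \<in> space M" "bounded A"
  shows "finite (A \<inter> X \<omega>)"
proof -
  have "\<forall>\<omega> \<in> space M. \<forall>A. bounded A \<longrightarrow> finite (X \<omega> \<inter> A)"
    using assms(1) unfolding poisson_point_process_def by (elim conjE)
  then show ?thesis using assms(2,3) by (simp add: Int_commute)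
qed

lemma
  assumes "poisson_point_process M lam X" "A \<in> sets borel" "bounded A"
  shows measurable_poisson_count: "(\<lambda>\<omega>. card (X \<omega> \<inter> A)) \<in> M \<rightarrow>\<^sub>M count_space UNIV"
    and distr_poisson_count: "distr M (count_space UNIV) (\<lambda>\<omega>. card (X \<omega> \<inter> A)) =
          measure_pmf (Po (lam * measure lborel A))"
proof -
  have "\<forall>A. A \<in> sets borel \<and> bounded A \<longrightarrow>
      (\<lambda>\<omega>. card (X \<omega> \<inter> A)) \<in> M \<rightarrow>\<^sub>M count_space UNIV \<and>
      distr M (count_space UNIV) (\<lambda>\<omega>. card (X \<omega> \<inter> A)) = measure_pmf (Po (lam * measure lborel A))"
    using assms(1) unfolding poisson_point_process_def by (elim conjE)
  then show "(\<lambda>\<omega>. card (X \<omega> \<inter> A)) \<in> M \<rightarrow>\<^sub>M count_space UNIV"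
    "distr M (count_space UNIV) (\<lambda>\<omega>. card (X \<omega> \<inter> A)) = measure_pmf (Po (lam * measure lborel A))"
    using assms(2,3) by blast+
qed

lemma
  fixes f :: "nat \<Rightarrow> real"
  assumes "poisson_point_process M lam X" "A \<in> sets borel" "bounded A"
  shows integral_poisson_count: "(\<integral>\<omega>. f (card (X \<omega> \<inter> A)) \<partial>M) =
          measure_pmf.expectation (Po (lam * measure lborel A)) f"
    and integrable_poisson_count: "integrable M (\<lambda>\<omega>. f (card (X \<omega> \<inter> A))) \<longleftrightarrow>
          integrable (Po (lam * measure lborel A)) f"
proof -
  have f: "f \<in> borel_measurable (count_space UNIV)" by simp
  show "(\<integral>\<omega>. f (card (X \<omega> \<inter> A)) \<partial>M) = measure_pmf.expectation (Po (lam * measure lborel A)) f"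
    using integral_distr[OF measurable_poisson_count[OF assms] f]
    unfolding distr_poisson_count[OF assms] by (rule sym)
  show "integrable M (\<lambda>\<omega>. f (card (X \<omega> \<inter> A))) \<longleftrightarrow> integrable (Po (lam * measure lborel A)) f"
    using integrable_distr_eq[OF measurable_poisson_count[OF assms] f]
    unfolding distr_poisson_count[OF assms] by (rule sym)
qed

text \<open>Over a countable basis there are only countably many finite colored families, so each
  event \<open>m \<le> F_col\<close> is a countable union of finite intersections of hitting events,
  and hitting is a positive count.\<close>

lemma measurable_F_col:
  fixes X :: "'w \<Rightarrow> (real ^ 'n) set"
  assumes ppp: "poisson_point_process M lam X"
  shows "(\<lambda>\<omega>. real (F_col X k t \<omega>)) \<in> borel_measurable M"
proof -
  define W :: "(real ^ 'n) set" where "W = cbox 0 (\<chi> i. t)"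
  obtain B :: "(real ^ 'n) set set" where B: "countable B" "topological_basis B"
    using ex_countable_basis by auto
  have "{\<omega> \<in> space M. m \<le> F_col X k t \<omega>} \<in> sets M" for m
  proof -
    define G where "G = {S. finite S \<and> S \<subseteq> B \<times> {1..k} \<and> m \<le> card S \<and> separated_colored 1 S}"
    have "countable {S. finite S \<and> S \<subseteq> B \<times> {1..k}}"
      using B by (intro countable_Collect_finite_subset) auto
    then have G: "countable G"
      by (rule countable_subset[rotated]) (auto simp: G_def)
    have hit: "{\<omega> \<in> space M. W \<inter> X \<omega> \<inter> Q \<noteq> {}} \<in> sets M" if "Q \<in> B" for Q
    proof -
      have "bounded (W \<inter> Q)" "W \<inter> Q \<in> sets borel"
        using topological_basis_open[OF B(2) that] by (auto simp: W_def)
      have "{\<omega> \<in> space M. 0 < card (X \<omega> \<inter> (W \<inter> Q))} =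
          (\<lambda>\<omega>. card (X \<omega> \<inter> (W \<inter> Q))) -` {0<..} \<inter> space M"
        by auto
      also have "\<dots> \<in> sets M"
        using \<open>bounded (W \<inter> Q)\<close> \<open>W \<inter> Q \<in> sets borel\<close>
        by (intro measurable_sets[OF measurable_poisson_count[OF ppp]]) auto
      finally have "{\<omega> \<in> space M. 0 < card (X \<omega> \<inter> (W \<inter> Q))} \<in> sets M" .
      \<comment> \<open>Local finiteness enters here, since \<open>card\<close> is 0 on infinite
        sets.\<close>
      moreover have "0 < card (X \<omega> \<inter> (W \<inter> Q)) \<longleftrightarrow> W \<inter> X \<omega> \<inter> Q \<noteq> {}" if "\<omega> \<in> space M" for \<omega>
        using poisson_point_process_finite[OF ppp that \<open>bounded (W \<inter> Q)\<close>]
        by (simp add: card_gt_0_iff Int_ac)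
      then have "{\<omega> \<in> space M. 0 < card (X \<omega> \<inter> (W \<inter> Q))} = {\<omega> \<in> space M. W \<inter> X \<omega> \<inter> Q \<noteq> {}}"
        by blast
      ultimately show ?thesis by simp
    qed
    have "{\<omega> \<in> space M. m \<le> F_col X k t \<omega>} =
      {\<omega> \<in> space M. \<exists>S \<in> G. \<forall>e \<in> S. W \<inter> X \<omega> \<inter> fst e \<noteq> {}}"
    proof (rule Collect_cong, rule conj_cong[OF refl])
      fix \<omega> assume "\<omega> \<in> space M"
      then have "finite (W \<inter> X \<omega>)"
        by (intro poisson_point_process_finite[OF ppp]) (auto simp: W_def)
      then have "m \<le> F_col X k t \<omega> \<longleftrightarrow>
          (\<exists>S. finite S \<and> S \<subseteq> B \<times> {1..k} \<and> m \<le> card S \<and> separated_colored 1 S \<and>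
             (\<forall>e \<in> S. W \<inter> X \<omega> \<inter> fst e \<noteq> {}))"
        unfolding F_col_def W_def by (rule le_max_colorable_iff_basis[OF _ B(2)])
      then show "m \<le> F_col X k t \<omega> \<longleftrightarrow> (\<exists>S \<in> G. \<forall>e \<in> S. W \<inter> X \<omega> \<inter> fst e \<noteq> {})"
        by (simp only: G_def Bex_def mem_Collect_eq conj_assoc)
    qed
    also have "\<dots> = (\<Union>S \<in> G. {\<omega> \<in> space M. \<forall>e \<in> S. W \<inter> X \<omega> \<inter> fst e \<noteq> {}})"
      by blast
    also have "\<dots> \<in> sets M"
    proof (rule sets.countable_UN''[OF G])
      fix S assume "S \<in> G"
      then have "finite S" "S \<subseteq> B \<times> {1..k}" by (auto simp: G_def)
      then show "{\<omega> \<in> space M. \<forall>e \<in> S. W \<inter> X \<omega> \<inter> fst e \<noteq> {}} \<in> sets M"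
        using hit by (intro sets.sets_Collect_finite_All) auto
    qed
    finally show ?thesis .
  qed
  moreover have "{\<omega> \<in> space M. a \<le> real (F_col X k t \<omega>)} =
      {\<omega> \<in> space M. nat \<lceil>a\<rceil> \<le> F_col X k t \<omega>}" for a
    by (auto simp: nat_le_iff ceiling_le_iff)
  ultimately show ?thesis
    unfolding borel_measurable_iff_ge by (simp only:) blast
qed

section \<open>Bounds on \<open>Fbar\<close> for a fixed window\<close>

context
  fixes M :: "'w measure" and X :: "'w \<Rightarrow> (real ^ 'n) set" and lam t :: real
  assumes lam: "lam > 0" and t: "t > 0" and ppp: "poisson_point_process M lam X"
begin

interpretation prob_space M
  using ppp by (simp add: poisson_point_process_def)

lemma measure_window: "measure lborel (cbox 0 (\<chi> i. t) :: (real ^ 'n) set) = t ^ CARD('n)"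
  using t by (subst content_cbox_cart) (auto simp: interval_ne_empty_cart)

lemma window_count:
  "integrable M (\<lambda>\<omega>. real (card (X \<omega> \<inter> cbox 0 (\<chi> i. t))))"
  "(\<integral>\<omega>. real (card (X \<omega> \<inter> cbox 0 (\<chi> i. t))) \<partial>M) = lam * t ^ CARD('n)"
  using lam t
  by (simp_all add: integral_poisson_count[OF ppp] integrable_poisson_count[OF ppp] Po_mean
      measure_window)

lemma F_col_le_count:
  assumes "\<omega> \<in> space M"
  shows "F_col X k t \<omega> \<le> card (X \<omega> \<inter> cbox 0 (\<chi> i. t))"
  unfolding F_col_def
  using max_colorable_le_card[OF poisson_point_process_finite[OF ppp assms bounded_cbox]]
  by (simp add: Int_commute)

text \<open>Dominated by the count of the window, which has finite mean. This rules out the default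
  value 0 of the integral in \<open>Fbar\<close>.\<close>

lemma integrable_F_col: "integrable M (\<lambda>\<omega>. real (F_col X k t \<omega>))"
  by (rule Bochner_Integration.integrable_bound[OF window_count(1) measurable_F_col[OF ppp]])
     (use F_col_le_count in \<open>auto intro!: AE_I2\<close>)

lemma Fbar_le_1: "Fbar M lam X k t \<le> 1"
proof -
  have "(\<integral>\<omega>. real (F_col X k t \<omega>) \<partial>M) \<le> lam * t ^ CARD('n)"
    unfolding window_count(2)[symmetric]
    by (intro integral_mono integrable_F_col window_count) (use F_col_le_count in auto)
  then show ?thesis
    using lam t by (simp add: Fbar_def)
qed

lemma Fbar_ge:
  assumes cov: "separated_cover s m (B :: nat \<Rightarrow> (real ^ 'n) set)" and s: "s > 0"
    and K: "m * K \<le> k"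
  defines "v \<equiv> measure lborel (cball (0 :: real ^ 'n) s)"
  shows "Po_min K (lam * v) / (lam * v) \<le> Fbar M lam X k t"
proof -
  define W :: "(real ^ 'n) set" where "W = cbox 0 (\<chi> i. t)"
  have W: "bounded W" "W \<in> sets borel" by (simp_all add: W_def)
  have v: "v > 0"
    unfolding v_def using s by (simp add: content_cball)
  obtain N :: nat and c y D where
    c: "\<And>j. j < N \<Longrightarrow> c j \<in> {1..m}"
    and sep: "\<And>j l. j < N \<Longrightarrow> l < N \<Longrightarrow> j \<noteq> l \<Longrightarrow> c j = c l \<Longrightarrow> dist (y j) (y l) > 1 + 2 * s"
    and D: "\<And>j. D j \<subseteq> W \<inter> cball (y j) s" "\<And>j. D j \<in> sets borel"
      "disjoint_family D" "(\<Union>j<N. D j) = W"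
    by (rule window_cells[OF cov s W]) (rule that; assumption)
  have Dc: "D j \<subseteq> cball (y j) s" for j using D(1) by blast
  have bD: "bounded (D j)" for j using D(1)[of j] W(1) bounded_subset by blast
  have fin: "D j \<in> fmeasurable lborel" for j
    using D(2) emeasure_bounded_finite[OF bD] by (intro fmeasurableI) auto
  define \<mu> where "\<mu> j = measure lborel (D j)" for j
  have \<mu>_le: "\<mu> j \<le> v" for j
  proof -
    have "\<mu> j \<le> measure lborel (cball (y j) s)"
      unfolding \<mu>_def using D(1,2) emeasure_bounded_finite[OF bounded_cball]
      by (intro measure_mono_fmeasurable fmeasurableI) auto
    then show ?thesis using s by (simp add: v_def content_cball)
  qed
  have "(\<Sum>j<N. \<mu> j) = measure lborel (\<Union>j<N. D j)"
    unfolding \<mu>_def using D(3) fin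
    by (intro measure_UNION'[symmetric]) (auto simp: disjoint_family_on_def pairwise_def disjnt_def)
  then have sum_\<mu>: "(\<Sum>j<N. \<mu> j) = t ^ CARD('n)"
    unfolding D(4) by (simp add: W_def measure_window)
  have int: "integrable M (\<lambda>\<omega>. real (min (card (X \<omega> \<inter> D j)) K))" for j
    unfolding integrable_poisson_count[OF ppp D(2) bD, of "\<lambda>n. real (min n K)"]
    by (rule measure_pmf.integrable_const_bound[where B=K]) auto
  \<comment> \<open>The target is split in proportion to the cell volumes, which sum to the volume
    of the window; each share is then compared with the truncated mean of its own cell.\<close>
  have "t ^ CARD('n) / v * Po_min K (lam * v) = (\<Sum>j<N. \<mu> j / v * Po_min K (lam * v))"
    by (simp add: sum_\<mu>[symmetric] sum_distrib_right sum_divide_distrib)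
  also have "\<dots> \<le> (\<Sum>j<N. Po_min K (lam * \<mu> j))"
  proof (rule sum_mono)
    fix j
    have "(lam * \<mu> j) * Po_min K (lam * v) \<le> (lam * v) * Po_min K (lam * \<mu> j)"
      using lam \<mu>_le by (intro Po_min_scale) (auto simp: \<mu>_def)
    then show "\<mu> j / v * Po_min K (lam * v) \<le> Po_min K (lam * \<mu> j)"
      using lam v by (simp add: field_simps)
  qed
  \<comment> \<open>Linearity of expectation, each count having law
    \<open>Po (lam * \<mu> j)\<close>.\<close>
  also have "\<dots> = (\<integral>\<omega>. (\<Sum>j<N. real (min (card (X \<omega> \<inter> D j)) K)) \<partial>M)"
    by (subst Bochner_Integration.integral_sum)
       (simp_all only: int Po_min_def \<mu>_def integral_poisson_count[OF ppp D(2) bD, of "\<lambda>n. real (min n K)"])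
  also have "\<dots> \<le> (\<integral>\<omega>. real (F_col X k t \<omega>) \<partial>M)"
  proof (rule integral_mono[OF _ integrable_F_col])
    fix \<omega> assume "\<omega> \<in> space M"
    then have "finite (W \<inter> X \<omega>)"
      using poisson_point_process_finite[OF ppp _ W(1)] by blast
    then have "(\<Sum>j<N. min (card (W \<inter> X \<omega> \<inter> D j)) K) \<le> max_colorable k 1 (W \<inter> X \<omega>)"
      by (rule max_colorable_ge_sum[where c=c and y=y and s=s, OF _ K])
         ((rule c sep Dc D(3); assumption)+)
    moreover have "W \<inter> X \<omega> \<inter> D j = X \<omega> \<inter> D j" for j using D(1) by blast
    ultimately have "(\<Sum>j<N. min (card (X \<omega> \<inter> D j)) K) \<le> F_col X k t \<omega>"
      by (simp add: F_col_def W_def)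
    then show "(\<Sum>j<N. real (min (card (X \<omega> \<inter> D j)) K)) \<le> real (F_col X k t \<omega>)"
      by (metis of_nat_le_iff of_nat_sum)
  qed (use int in auto)
  finally show ?thesis
    using lam t v by (simp add: Fbar_def field_simps)
qed

end

section \<open>Bounds on the constant and its limit\<close>

text \<open>The bound of \<open>Fbar_ge\<close> does not depend on t, so it passes to the infimum;
  \<open>ball_vol\<close> is the Lebesgue measure of the closed ball.\<close>

lemma a_const_ge:
  fixes X :: "'w \<Rightarrow> (real ^ 'n) set"
  assumes lam: "lam > 0" and ppp: "poisson_point_process M lam X" and s: "s > 0"
  defines "v \<equiv> ball_vol CARD('n) s"
  shows "Po_min (k div cover_num TYPE('n) s) (lam * v) / (lam * v) \<le> a_const M lam X k"
proof -
  obtain B :: "nat \<Rightarrow> (real ^ 'n) set" where B: "separated_cover s (cover_num TYPE('n) s) B"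
    using cover_num_cover[OF s] by blast
  have v: "v = measure lborel (cball (0 :: real ^ 'n) s)"
    using s by (simp add: v_def ball_vol_def content_cball unit_ball_vol_def)
  show ?thesis
    unfolding a_const_def v
    by (intro cINF_greatest Fbar_ge[OF lam _ ppp B s]) auto
qed

text \<open>The infimum is at most its value at t = 1; the lower bound 0 of \<open>Fbar\<close>
  makes it a genuine infimum.\<close>

lemma a_const_le_1:
  fixes X :: "'w \<Rightarrow> (real ^ 'n) set"
  assumes lam: "lam > 0" and ppp: "poisson_point_process M lam X"
  shows "a_const M lam X k \<le> 1"
proof -
  have "bdd_below ((\<lambda>t. Fbar M lam X k t) ` {0<..})"
    using lam by (intro bdd_belowI2[where m=0]) (auto simp: Fbar_def)
  then have "a_const M lam X k \<le> Fbar M lam X k 1"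
    unfolding a_const_def by (rule cINF_lower) simp
  also have "\<dots> \<le> 1" by (rule Fbar_le_1[OF lam _ ppp]) simp
  finally show ?thesis .
qed

theorem mainTheorem6:
  fixes M :: "'w measure" and X :: "'w \<Rightarrow> (real ^ 'n) set" and lam :: real
  assumes "CARD('n) > 1"
    and "lam > 0"
    and "poisson_point_process M lam X"
  shows "(\<forall>k::nat. \<forall>s::real. k \<ge> 1 \<and> s > 0 \<longrightarrow>
            a_const M lam X k \<ge>
              measure_pmf.expectation (Po (lam * ball_vol CARD('n) s))
                (\<lambda>n. min (real n) (real_of_int \<lfloor>real k / real (cover_num TYPE('n) s)\<rfloor>))
              / (lam * ball_vol CARD('n) s))
       \<and> (\<lambda>k. a_const M lam X k) \<longlonglongrightarrow> 1"
proof (intro conjI allI impI)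
  fix k :: nat and s :: real
  assume ks: "k \<ge> 1 \<and> s > 0"
  have "(\<lambda>n. min (real n) (real_of_int \<lfloor>real k / real (cover_num TYPE('n) s)\<rfloor>)) =
      (\<lambda>n. real (min n (k div cover_num TYPE('n) s)))"
    by (simp add: floor_divide_of_nat_eq of_nat_min)
  then show "a_const M lam X k \<ge>
      measure_pmf.expectation (Po (lam * ball_vol CARD('n) s))
        (\<lambda>n. min (real n) (real_of_int \<lfloor>real k / real (cover_num TYPE('n) s)\<rfloor>))
      / (lam * ball_vol CARD('n) s)"
    using a_const_ge[OF assms(2,3), of s k] ks by (simp add: Po_min_def)
next
  \<comment> \<open>For the limit the radius is fixed at s = 1, so only the truncation level
    \<open>k div m\<close> varies; the constant is squeezed between the resulting lower bound and
    1.\<close>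
  define m where "m = cover_num TYPE('n) 1"
  define \<mu> where "\<mu> = lam * ball_vol CARD('n) 1"
  have "\<mu> > 0"
    using assms(2) unit_ball_vol_pos[of "CARD('n)"]
    by (simp add: \<mu>_def ball_vol_def unit_ball_vol_def del: unit_ball_vol_pos)
  have "m > 0" by (simp add: m_def cover_num_pos)
  have "filterlim (\<lambda>k. k div m) at_top sequentially"
    unfolding filterlim_at_top
  proof
    fix Z
    show "\<forall>\<^sub>F k in sequentially. Z \<le> k div m"
      using eventually_ge_at_top[of "Z * m"]
      by eventually_elim (use \<open>m > 0\<close> in \<open>simp add: less_eq_div_iff_mult_less_eq\<close>)
  qed
  from filterlim_compose[OF Po_min_tendsto this] \<open>\<mu> > 0\<close>
  have "(\<lambda>k. Po_min (k div m) \<mu>) \<longlonglongrightarrow> \<mu>" by simp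
  then have "(\<lambda>k. Po_min (k div m) \<mu> / \<mu>) \<longlonglongrightarrow> \<mu> / \<mu>"
    using \<open>\<mu> > 0\<close> by (intro tendsto_divide) auto
  then have "(\<lambda>k. Po_min (k div m) \<mu> / \<mu>) \<longlonglongrightarrow> 1"
    using \<open>\<mu> > 0\<close> by simp
  then show "(\<lambda>k. a_const M lam X k) \<longlonglongrightarrow> 1"
  proof (rule tendsto_sandwich[OF _ _ _ tendsto_const, rotated 2])
    show "\<forall>\<^sub>F k in sequentially. Po_min (k div m) \<mu> / \<mu> \<le> a_const M lam X k"
      using a_const_ge[OF assms(2,3) zero_less_one] by (simp add: m_def \<mu>_def)
    show "\<forall>\<^sub>F k in sequentially. a_const M lam X k \<le> 1"
      using a_const_le_1[OF assms(2,3)] by simp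
  qed
qed

end
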